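(* Let $A$ be an anniseparable C*-algebra and let $B,C\in[A]^\perp$. If $B\precsim C$ and $C\precsim B$, then $B\sim C$.
   Context: For $a,b\in A$ write $a\perp b$ if $ab=0=ab^*$, and for $S\subseteq A$ put $S^\perp=\{b\in A:s\perp b\text{ for all }s\in S\}$. An annihilator of $A$ is a set of the form $S^\perp$, $S\subseteq A$; $[A]^\perp$ is the set of annihilators. $A$ is anniseparable if every $B\in[A]^\perp$ is of the form $S^\perp$ for some countable $S\subseteq A$. Annihilators $B,C$ are equivalent, $B\sim C$, if there is $a\in A$ with $\{a\}^{\perp\perp}=B$ and $\{a^*\}^{\perp\perp}=C$; and $B\precsim C$ if $B\sim D\subseteq C$ for some $D\in[A]^\perp$. *)

theory Defs
  imports "HOL-Analysis.Analysis"
begin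

text \<open>
  A C*-algebra is a complex Banach algebra with an involution satisfying the C*-identity.
  It is not assumed to have a unit, and the zero algebra is allowed.  The superclasses provide
  the norm, completeness, the ring structure and submultiplicativity of the norm; the axiom
  \<open>scaleR_eq_cscale\<close> ties their real scalar multiplication to the complex one.
\<close>

class cstar_algebra = real_normed_algebra + banach +
  fixes cscale :: "complex \<Rightarrow> 'a \<Rightarrow> 'a"  (infixr \<open>*\<^sub>\<bbbC>\<close> 75)
    and adj :: "'a \<Rightarrow> 'a"
  assumes cscale_add_right: "c *\<^sub>\<bbbC> (x + y) = c *\<^sub>\<bbbC> x + c *\<^sub>\<bbbC> y"
    and cscale_add_left: "(c + d) *\<^sub>\<bbbC> x = c *\<^sub>\<bbbC> x + d *\<^sub>\<bbbC> x"
    and cscale_cscale: "c *\<^sub>\<bbbC> (d *\<^sub>\<bbbC> x) = (c * d) *\<^sub>\<bbbC> x"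
    and scaleR_eq_cscale: "scaleR r x = complex_of_real r *\<^sub>\<bbbC> x"
    and mult_cscale_left: "(c *\<^sub>\<bbbC> x) * y = c *\<^sub>\<bbbC> (x * y)"
    and mult_cscale_right: "x * (c *\<^sub>\<bbbC> y) = c *\<^sub>\<bbbC> (x * y)"
    and norm_cscale: "norm (c *\<^sub>\<bbbC> x) = cmod c * norm x"
    and adj_adj: "adj (adj x) = x"
    and adj_add: "adj (x + y) = adj x + adj y"
    and adj_cscale: "adj (c *\<^sub>\<bbbC> x) = cnj c *\<^sub>\<bbbC> adj x"
    and adj_mult: "adj (x * y) = adj y * adj x"
    and cstar_identity: "norm (adj x * x) = (norm x)\<^sup>2"

text \<open>The relation \<open>perp\<close> is not symmetric in general; the element of \<open>S\<close> stands on the left.\<close>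

definition perp :: "'a::cstar_algebra \<Rightarrow> 'a \<Rightarrow> bool"
  where "perp a b \<longleftrightarrow> a * b = 0 \<and> a * adj b = 0"

definition ann :: "'a::cstar_algebra set \<Rightarrow> 'a set"
  where "ann S = {b. \<forall>s\<in>S. perp s b}"

definition annihilators :: "'a::cstar_algebra set set"
  where "annihilators = range ann"

text \<open>The argument only serves to name the type that carries the algebra.\<close>

definition anniseparable :: "'a::cstar_algebra itself \<Rightarrow> bool"
  where "anniseparable _ \<longleftrightarrow>
    (\<forall>B\<in>(annihilators :: 'a set set). \<exists>S. countable S \<and> B = ann S)"

definition ann_equiv :: "'a::cstar_algebra set \<Rightarrow> 'a set \<Rightarrow> bool"  (infix \<open>\<sim>\<^sub>a\<close> 50)
  where "B \<sim>\<^sub>a C \<longleftrightarrow> (\<exists>a. ann (ann {a}) = B \<and> ann (ann {adj a}) = C)"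

definition ann_subequiv :: "'a::cstar_algebra set \<Rightarrow> 'a set \<Rightarrow> bool"  (infix \<open>\<lesssim>\<^sub>a\<close> 50)
  where "B \<lesssim>\<^sub>a C \<longleftrightarrow> (\<exists>D\<in>annihilators. B \<sim>\<^sub>a D \<and> D \<subseteq> C)"

end

theory Submission
  imports Defs "HOL-Computational_Algebra.Formal_Power_Series" "HOL-Real_Asymp.Real_Asymp"
begin

text \<open>
The annihilator generated by \<open>x\<close> is determined by the right kernel \<open>{v. x v = 0}\<close>
(\<open>bi_annihilator_subset_iff\<close>), so the theorem is about kernels: given \<open>a\<close> and \<open>b\<close> such that \<open>a\<close> maps
\<open>B\<close> injectively into \<open>C\<close> and \<open>b\<close> maps \<open>C\<close> injectively into \<open>B\<close>, find \<open>u\<close> with the kernel of \<open>a\<close> whose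
adjoint has the kernel of \<open>b\<close>. The classical proof cuts \<open>B\<close> and \<open>C\<close> into orthogonal pieces and adds
partial isometries. It rests on orthomodularity: an annihilator and its relative complement should
span the larger one. The argument below does without it.

It uses two observations. First, let \<open>X \<subseteq> B\<close> be the left support of \<open>x\<close>, and \<open>Y\<close> its right support.
Then \<open>B\<close> is equivalent to the external orthogonal sum \<open>Y \<oplus> P\<close> for some annihilator \<open>P\<close>, which need not
lie in \<open>B\<close>: if \<open>c\<close> is a positive generator of \<open>B\<close> and \<open>z\<close> generates the orthocomplement of \<open>X\<close>, the column with
entries \<open>x\<^sup>*\<close> and \<open>z c\<close> is injective on \<open>B\<close>, and its adjoint is injective on \<open>Y \<oplus> P\<close>, where \<open>P\<close> is the left
support of \<open>z c\<close>. For \<open>x = b\<close> this identifies \<open>B\<close> with \<open>C \<oplus> P\<close>. Secondly, \<open>a\<close> then becomes an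
injective map \<open>C \<oplus> P \<rightarrow> C\<close>, and composing its restrictions to \<open>C\<close> and \<open>P\<close> gives maps \<open>P \<rightarrow> C\<close>, one for
each natural number, that are jointly injective though not orthogonal (\<open>copies_independent\<close>). They form
a row that is injective on the countable orthogonal sum of copies of \<open>P\<close>. By the first observation, with
this row in the place of \<open>x\<close>, \<open>C\<close> is equivalent to the sum of these copies and a remainder \<open>R\<close>. Shifting
the copies absorbs the additional \<open>P\<close>, so that \<open>C \<oplus> P\<close> is equivalent to \<open>C\<close>. Composing all these maps
leads back to a single element of the algebra, the explicit \<open>u\<close> of \<open>schroeder_bernstein_small\<close>.

Anniseparability provides \<open>z\<close> and its analogue for \<open>R\<close>. An orthocomplement is the common kernel of a
sequence \<open>x\<^sub>n\<close>, and the generator is a weighted sum of the elements \<open>x\<^sub>n\<^sup>* x\<^sub>n\<close>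
(\<open>common_kernel_of_sequence\<close>). This needs that such a sum vanishes only if all its terms do, that is, the
positivity of \<open>x\<^sup>* x\<close>. It is proved from the binomial series of the square root and the norm
characterisation of positivity, with \<open>1 - p\<close> acting by left multiplication, so that neither a unit nor
spectral theory is needed.
\<close>

section \<open>The involution\<close>

lemma adj_scaleR: "adj (r *\<^sub>R x) = r *\<^sub>R adj (x::'a::cstar_algebra)"
  by (simp add: scaleR_eq_cscale adj_cscale)

lemma adj_zero [simp]: "adj (0::'a::cstar_algebra) = 0"
  using adj_scaleR[of 0 "0::'a"] by simp

lemma adj_uminus: "adj (- x) = - adj (x::'a::cstar_algebra)"
  using adj_scaleR[of "-1" x] by simp

lemma adj_diff: "adj (x - y) = adj x - adj (y::'a::cstar_algebra)"
  using adj_add[of x "- y"] by (simp add: adj_uminus)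

lemmas adj_simps = adj_adj adj_add adj_mult adj_scaleR adj_uminus adj_diff

lemma norm_adj [simp]: "norm (adj x) = norm (x::'a::cstar_algebra)"
proof -
  have le: "norm x \<le> norm (adj x)" for x :: 'a
  proof (cases "x = 0")
    case False
    have "norm x * norm x \<le> norm (adj x) * norm x"
      using norm_mult_ineq[of "adj x" x] by (simp add: cstar_identity power2_eq_square)
    then show ?thesis using False by simp
  qed simp
  show ?thesis using le[of x] le[of "adj x"] by (simp add: adj_adj)
qed

lemma bounded_linear_adj: "bounded_linear (adj :: 'a::cstar_algebra \<Rightarrow> 'a)"
  by (rule bounded_linear_intro[of _ 1]) (simp_all add: adj_add adj_scaleR)

lemma adj_mult_self_eq_0D: "adj x * x = 0 \<Longrightarrow> x = (0::'a::cstar_algebra)"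
  using cstar_identity[of x] by simp

lemma mult_adj_self_eq_0D: "x * adj x = 0 \<Longrightarrow> x = (0::'a::cstar_algebra)"
  by (metis adj_adj adj_mult_self_eq_0D adj_zero)

lemma adj_mult_cancel: "adj x * (x * y) = 0 \<longleftrightarrow> x * y = (0::'a::cstar_algebra)"
proof
  assume "adj x * (x * y) = 0"
  then have "adj (x * y) * (x * y) = 0" by (simp add: adj_mult mult.assoc)
  then show "x * y = 0" by (rule adj_mult_self_eq_0D)
qed simp

lemma mult_self_adj_cancel: "x * (y * adj y) = 0 \<longleftrightarrow> x * y = (0::'a::cstar_algebra)"
proof
  assume "x * (y * adj y) = 0"
  then have "(x * (y * adj y)) * adj x = 0" by simp
  then have "(x * y) * adj (x * y) = 0" by (simp add: adj_mult mult.assoc)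
  then show "x * y = 0" by (rule mult_adj_self_eq_0D)
qed (simp flip: mult.assoc)

lemma norm_square_selfadjoint: "adj k = k \<Longrightarrow> norm (k * k) = (norm (k::'a::cstar_algebra))\<^sup>2"
  using cstar_identity[of k] by simp

lemma norm_le_if_left_mult_le:
  fixes x :: "'a::cstar_algebra"
  assumes "0 \<le> c" and mult_le: "\<And>y. norm (x * y) \<le> c * norm y"
  shows "norm x \<le> c"
proof (cases "x = 0")
  case False
  have "norm x * norm x \<le> c * norm x"
    using mult_le[of "adj x"] cstar_identity[of "adj x"] by (simp add: adj_adj power2_eq_square)
  then show ?thesis using False by simp
qed (use assms in simp)

lemma cscale_zero_right [simp]: "c *\<^sub>\<bbbC> (0::'a::cstar_algebra) = 0"
  using cscale_add_right[of c 0 "0::'a"] by simp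

lemma cscale_minus: "c *\<^sub>\<bbbC> (- x) = - (c *\<^sub>\<bbbC> (x::'a::cstar_algebra))"
  using cscale_add_right[of c x "- x"] by (simp add: eq_neg_iff_add_eq_0 add.commute)

lemma cscale_diff: "c *\<^sub>\<bbbC> (x - y) = c *\<^sub>\<bbbC> x - c *\<^sub>\<bbbC> (y::'a::cstar_algebra)"
  using cscale_add_right[of c x "- y"] by (simp add: cscale_minus)

lemma cscale_minus_left: "(- c) *\<^sub>\<bbbC> x = - (c *\<^sub>\<bbbC> (x::'a::cstar_algebra))"
proof -
  have "(0::complex) *\<^sub>\<bbbC> x = 0" using scaleR_eq_cscale[of 0 x] by simp
  then show ?thesis using cscale_add_left[of c "- c" x] by (simp add: eq_neg_iff_add_eq_0 add.commute)
qed

lemma cscale_ii_ii: "\<i> *\<^sub>\<bbbC> (\<i> *\<^sub>\<bbbC> x) = - (x::'a::cstar_algebra)"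
proof -
  have "(1::complex) *\<^sub>\<bbbC> x = x" using scaleR_eq_cscale[of 1 x] by simp
  then show ?thesis by (simp add: cscale_cscale cscale_minus_left)
qed

lemmas cscale_simps = cscale_add_right cscale_minus cscale_diff cscale_minus_left cscale_ii_ii
  mult_cscale_left mult_cscale_right adj_cscale

section \<open>The binomial series of the square root\<close>

text \<open>The coefficients in \<open>1 - sqrt (1 - x) = (\<Sum>n. sqrt_coeff n * x ^ n)\<close>. They are nonnegative with
sum 1, so the series converges in norm whenever the powers of \<open>x\<close> are bounded, in particular at the
boundary of the unit ball, where it is needed.\<close>

definition sqrt_coeff :: "nat \<Rightarrow> real"
  where "sqrt_coeff n = (if n = 0 then 0 else - ((1/2 gchoose n) * (- 1) ^ n))"

lemma sqrt_coeff_0 [simp]: "sqrt_coeff 0 = 0"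
  by (simp add: sqrt_coeff_def)

lemma sqrt_coeff_1 [simp]: "sqrt_coeff (Suc 0) = 1/2"
  by (simp add: sqrt_coeff_def)

lemma sqrt_coeff_Suc:
  assumes "0 < n"
  shows "sqrt_coeff (Suc n) = (real n - 1/2) / (real n + 1) * sqrt_coeff n"
proof -
  have step: "(1/2 gchoose Suc n) = (1/2 - real n) / (real n + 1) * (1/2 gchoose n)"
    using gbinomial_mult_1[of "1/2 :: real" n] by (simp add: field_simps)
  show ?thesis unfolding sqrt_coeff_def step using assms by (simp add: field_simps)
qed

lemma sqrt_coeff_nonneg: "0 \<le> sqrt_coeff n"
proof (induction n)
  case (Suc n)
  show ?case
  proof (cases "n = 0")
    case False
    then show ?thesis using Suc by (simp add: sqrt_coeff_Suc)
  qed simp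
qed simp

text \<open>With \<open>s\<close> the power series, this is \<open>s\<^sup>2 = 2 s - x\<close>, that is \<open>(1 - s)\<^sup>2 = 1 - x\<close>. It is Vandermonde's
identity \<open>(\<Sum>i\<le>n. (1/2 gchoose i) * (1/2 gchoose (n - i))) = 1 gchoose n\<close>.\<close>

lemma sqrt_coeff_convolution:
  "(\<Sum>i\<le>n. sqrt_coeff i * sqrt_coeff (n - i)) = 2 * sqrt_coeff n - (if n = 1 then 1 else 0)"
proof -
  define c where "c k = (1/2 gchoose k) * (- 1 :: real) ^ k" for k
  have c: "sqrt_coeff k = (if k = 0 then 1 else 0) - c k" for k
    by (simp add: c_def sqrt_coeff_def)
  have "(\<Sum>i\<le>n. c i * c (n - i)) = (\<Sum>i\<le>n. ((1/2 gchoose i) * (1/2 gchoose (n - i))) * (- 1) ^ n)"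
    by (rule sum.cong) (auto simp: c_def power_add[symmetric] mult_ac intro!: arg_cong2[where f = "(*)"])
  also have "\<dots> = (1 gchoose n) * (- 1) ^ n"
    using gbinomial_Vandermonde[of "1/2 :: real" "1/2" n]
    by (simp add: sum_distrib_right[symmetric] atMost_atLeast0)
  also have "(1 :: real) gchoose n = (if n \<le> 1 then 1 else 0)"
    using binomial_gbinomial[of 1 n, where 'a = real]
    by (cases "n \<le> 1") (auto simp: le_Suc_eq binomial_eq_0)
  finally have cc: "(\<Sum>i\<le>n. c i * c (n - i)) = (if n \<le> 1 then 1 else 0) * (- 1) ^ n" .
  have delta: "(\<Sum>i\<le>n. (if i = 0 then 1 else 0) * f i) = f 0" for f :: "nat \<Rightarrow> real"
    by (simp add: if_distrib[of "\<lambda>x. x * _"] cong: if_cong)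
  have delta': "(\<Sum>i\<le>n. f i * (if n - i = 0 then 1 else 0)) = f n" for f :: "nat \<Rightarrow> real"
  proof -
    have "(\<Sum>i\<le>n. f i * (if n - i = 0 then 1 else 0)) = (\<Sum>i\<le>n. if i = n then f i else 0)"
      by (rule sum.cong) auto
    then show ?thesis by simp
  qed
  have "(\<Sum>i\<le>n. sqrt_coeff i * sqrt_coeff (n - i))
      = (\<Sum>i\<le>n. (if i = 0 then 1 else 0) * (if n - i = 0 then 1 else 0))
        - (\<Sum>i\<le>n. (if i = 0 then 1 else 0) * c (n - i))
        - (\<Sum>i\<le>n. c i * (if n - i = 0 then 1 else 0)) + (\<Sum>i\<le>n. c i * c (n - i))"
    unfolding sum_subtractf[symmetric] sum.distrib[symmetric]
    by (rule sum.cong) (auto simp: c algebra_simps)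
  also have "\<dots> = (if n = 0 then 1 else 0) - c n - c n + (if n \<le> 1 then 1 else 0) * (- 1) ^ n"
    unfolding delta delta' cc by simp
  also have "\<dots> = 2 * sqrt_coeff n - (if n = 1 then 1 else 0)"
    by (auto simp: c le_Suc_eq)
  finally show ?thesis .
qed

text \<open>The alternating partial sums of the binomial coefficients of \<open>1/2\<close> telescope to a binomial
coefficient of \<open>- 1/2\<close>, whose sign is known.\<close>

lemma sum_sqrt_coeff_le_1: "(\<Sum>i<n. sqrt_coeff i) \<le> 1"
proof -
  have pos: "0 \<le> (- 1) ^ m * (- 1/2 gchoose m :: real)" for m
  proof (induction m)
    case (Suc m)
    have "(- 1/2 gchoose Suc m :: real) = (- 1/2 - real m) / (real m + 1) * (- 1/2 gchoose m)"
      using gbinomial_mult_1[of "- 1/2 :: real" m] by (simp add: field_simps)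
    then have "(- 1) ^ Suc m * (- 1/2 gchoose Suc m :: real)
        = (1/2 + real m) / (real m + 1) * ((- 1) ^ m * (- 1/2 gchoose m))"
      by (simp only:) (simp add: field_simps)
    then show ?case using Suc by simp
  qed simp
  have "(\<Sum>i\<le>n. sqrt_coeff i) = 1 - (\<Sum>i\<le>n. (1/2 gchoose i) * (- 1) ^ i)"
    by (induction n) (auto simp: sqrt_coeff_def)
  also have "\<dots> \<le> 1"
    using pos[of n] gbinomial_sum_lower_neg[of "1/2 :: real" n] by simp
  finally have "(\<Sum>i\<le>n. sqrt_coeff i) \<le> 1" .
  moreover have "(\<Sum>i<n. sqrt_coeff i) \<le> (\<Sum>i\<le>n. sqrt_coeff i)"
    by (rule sum_mono2) (auto simp: sqrt_coeff_nonneg)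
  ultimately show ?thesis by simp
qed

lemma summable_sqrt_coeff: "summable sqrt_coeff"
  by (rule summableI_nonneg_bounded[OF sqrt_coeff_nonneg sum_sqrt_coeff_le_1])

lemma summable_norm_sqrt_series:
  fixes X :: "nat \<Rightarrow> 'b::{real_normed_algebra,banach}"
  assumes "\<And>n. norm (X n) \<le> K"
  shows "summable (\<lambda>n. norm (sqrt_coeff n *\<^sub>R X n))"
proof (rule summable_comparison_test'[OF summable_mult[OF summable_sqrt_coeff, of K]])
  fix n
  have "sqrt_coeff n * norm (X n) \<le> sqrt_coeff n * K"
    by (rule mult_left_mono[OF assms sqrt_coeff_nonneg])
  then show "norm (norm (sqrt_coeff n *\<^sub>R X n)) \<le> K * sqrt_coeff n"
    using sqrt_coeff_nonneg[of n] by (simp add: mult.commute)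
qed

lemma summable_sqrt_series:
  fixes X :: "nat \<Rightarrow> 'b::{real_normed_algebra,banach}"
  assumes "\<And>n. norm (X n) \<le> K"
  shows "summable (\<lambda>n. sqrt_coeff n *\<^sub>R X n)"
  by (rule summable_norm_cancel[OF summable_norm_sqrt_series[of X, OF assms]])

lemma sqrt_series_mult_sums:
  fixes X Y :: "nat \<Rightarrow> 'b::{real_normed_algebra,banach}"
  assumes "\<And>n. norm (X n) \<le> K" and "\<And>n. norm (Y n) \<le> L"
  shows "(\<lambda>n. \<Sum>i\<le>n. (sqrt_coeff i * sqrt_coeff (n - i)) *\<^sub>R (X i * Y (n - i)))
     sums ((\<Sum>n. sqrt_coeff n *\<^sub>R X n) * (\<Sum>n. sqrt_coeff n *\<^sub>R Y n))"
  using Cauchy_product_sums[OF summable_norm_sqrt_series[of X, OF assms(1)]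
      summable_norm_sqrt_series[of Y, OF assms(2)]]
  by (simp add: mult.commute)

text \<open>The convolution identity makes the sum \<open>s\<close> a root of \<open>s\<^sup>2 = 2 s - 1\<close>.\<close>

lemma suminf_sqrt_coeff: "(\<Sum>n. sqrt_coeff n) = 1"
proof -
  let ?s = "\<Sum>n. sqrt_coeff n"
  have "(\<lambda>n. 2 * sqrt_coeff n - (if n = 1 then 1 else 0)) sums (?s * ?s)"
    using sqrt_series_mult_sums[of "\<lambda>_. 1 :: real" 1 "\<lambda>_. 1" 1]
    by (simp add: sqrt_coeff_convolution)
  moreover have "(\<lambda>n. 2 * sqrt_coeff n - (if n = 1 then 1 else 0)) sums (2 * ?s - 1)"
    by (intro sums_diff sums_mult summable_sums summable_sqrt_coeff sums_single)
  ultimately have "?s * ?s = 2 * ?s - 1" by (rule sums_unique2)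
  then have "(?s - 1)\<^sup>2 = 0" by (simp add: power2_eq_square algebra_simps)
  then show ?thesis by simp
qed

lemma sum_triangle:
  fixes f :: "nat \<Rightarrow> nat \<Rightarrow> 'c::comm_monoid_add"
  shows "(\<Sum>n<N. \<Sum>i\<le>n. f i (n - i)) = (\<Sum>i<N. \<Sum>j<N - i. f i j)"
proof -
  have "(\<Sum>n<N. \<Sum>i\<le>n. f i (n - i)) = (\<Sum>(i, j)\<in>{(i, j). i + j < N}. f i j)"
    by (rule sum.triangle_reindex[symmetric])
  also have "{(i, j). i + j < N} = (SIGMA i:{..<N}. {..<N - i})" by auto
  finally show ?thesis by (simp add: sum.Sigma)
qed

text \<open>The Cauchy product of \<open>\<Sum>n. sqrt_coeff n *\<^sub>R X n\<close> with the scalar series \<open>\<Sum>n. sqrt_coeff n = 1\<close>. In an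
algebra with unit this would be an instance of the Cauchy product formula.\<close>

lemma sqrt_coeff_convolution_vector_sums:
  fixes X :: "nat \<Rightarrow> 'b::banach"
  assumes bd: "\<And>n. norm (X n) \<le> K" and X: "(\<lambda>n. sqrt_coeff n *\<^sub>R X n) sums s"
  shows "(\<lambda>n. \<Sum>i\<le>n. (sqrt_coeff i * sqrt_coeff (n - i)) *\<^sub>R X i) sums s"
proof -
  define S where "S n = (\<Sum>j<n. sqrt_coeff j)" for n
  have S1: "S n \<le> 1" for n by (simp add: S_def sum_sqrt_coeff_le_1)
  have S: "S \<longlonglongrightarrow> 1"
    using summable_sums[OF summable_sqrt_coeff] unfolding suminf_sqrt_coeff sums_def S_def .
  \<comment> \<open>The scalar Cauchy product bounds the distance between the partial sums of the two series.\<close>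
  have "(\<lambda>n. \<Sum>i\<le>n. sqrt_coeff i * sqrt_coeff (n - i)) sums (1 * 1)"
    using sqrt_series_mult_sums[of "\<lambda>_. 1 :: real" 1 "\<lambda>_. 1" 1] suminf_sqrt_coeff by simp
  then have "(\<lambda>N. \<Sum>i<N. sqrt_coeff i * S (N - i)) \<longlonglongrightarrow> 1"
    unfolding sums_def sum_triangle[of "\<lambda>i j. sqrt_coeff i * sqrt_coeff j"] by (simp add: S_def sum_distrib_left)
  then have "(\<lambda>N. K * (S N - (\<Sum>i<N. sqrt_coeff i * S (N - i)))) \<longlonglongrightarrow> K * (1 - 1)"
    by (intro tendsto_intros S)
  then have lim: "(\<lambda>N. K * (S N - (\<Sum>i<N. sqrt_coeff i * S (N - i)))) \<longlonglongrightarrow> 0" by simp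
  have "norm ((\<Sum>n<N. \<Sum>i\<le>n. (sqrt_coeff i * sqrt_coeff (n - i)) *\<^sub>R X i) - (\<Sum>n<N. sqrt_coeff n *\<^sub>R X n))
     \<le> K * (S N - (\<Sum>i<N. sqrt_coeff i * S (N - i)))" for N
  proof -
    have "(\<Sum>n<N. sqrt_coeff n *\<^sub>R X n) - (\<Sum>n<N. \<Sum>i\<le>n. (sqrt_coeff i * sqrt_coeff (n - i)) *\<^sub>R X i)
        = (\<Sum>i<N. (sqrt_coeff i * (1 - S (N - i))) *\<^sub>R X i)"
      unfolding sum_triangle[of "\<lambda>i j. (sqrt_coeff i * sqrt_coeff j) *\<^sub>R X i"] sum_subtractf[symmetric]
      by (rule sum.cong)
        (simp_all add: S_def scaleR_sum_left[symmetric] sum_distrib_left algebra_simps)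
    also have "norm \<dots> \<le> (\<Sum>i<N. K * (sqrt_coeff i * (1 - S (N - i))))"
    proof (rule sum_norm_le)
      fix i
      have "0 \<le> sqrt_coeff i * (1 - S (N - i))" using S1 by (simp add: sqrt_coeff_nonneg)
      then show "norm ((sqrt_coeff i * (1 - S (N - i))) *\<^sub>R X i) \<le> K * (sqrt_coeff i * (1 - S (N - i)))"
        unfolding norm_scaleR by (metis abs_of_nonneg bd mult.commute mult_right_mono)
    qed
    also have "\<dots> = K * (S N - (\<Sum>i<N. sqrt_coeff i * S (N - i)))"
      by (simp add: S_def[of N] sum_distrib_left right_diff_distrib sum_subtractf)
    finally show ?thesis by (simp add: norm_minus_commute)
  qed
  then have "(\<lambda>N. (\<Sum>n<N. \<Sum>i\<le>n. (sqrt_coeff i * sqrt_coeff (n - i)) *\<^sub>R X i) - (\<Sum>n<N. sqrt_coeff n *\<^sub>R X n)) \<longlonglongrightarrow> 0"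
    by (intro Lim_null_comparison[OF _ lim] always_eventually allI)
  with X show ?thesis unfolding sums_def by (rule Lim_transform)
qed

lemma sqrt_series_adj:
  fixes X :: "nat \<Rightarrow> 'a::cstar_algebra"
  assumes "\<And>n. norm (X n) \<le> K" and "\<And>n. adj (X n) = X n"
  shows "adj (\<Sum>n. sqrt_coeff n *\<^sub>R X n) = (\<Sum>n. sqrt_coeff n *\<^sub>R X n)"
  using bounded_linear.suminf[OF bounded_linear_adj summable_sqrt_series[of X, OF assms(1)]] assms(2)
  by (simp add: adj_scaleR)

lemma sqrt_series_commute:
  fixes X :: "nat \<Rightarrow> 'b::{real_normed_algebra,banach}"
  assumes bd: "\<And>n. norm (X n) \<le> K" and comm: "\<And>n. v * X n = X n * v"
  shows "v * (\<Sum>n. sqrt_coeff n *\<^sub>R X n) = (\<Sum>n. sqrt_coeff n *\<^sub>R X n) * v"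
  using bounded_linear.suminf[OF bounded_linear_mult_right[of v] summable_sqrt_series[of X, OF bd]]
    bounded_linear.suminf[OF bounded_linear_mult_left[of v] summable_sqrt_series[of X, OF bd]] comm
  by simp

section \<open>Squares and square roots\<close>

text \<open>In the algebra with adjoined unit this is \<open>norm (1 - p) \<le> 1\<close>. Letting \<open>1 - p\<close> act by left
multiplication avoids constructing that algebra. For self-adjoint \<open>p\<close> the condition says that the
spectrum of \<open>p\<close> lies in \<open>[0, 2]\<close>.\<close>

definition one_minus_contraction :: "'a::cstar_algebra \<Rightarrow> bool"
  where "one_minus_contraction p \<longleftrightarrow> (\<forall>y. norm (y - p * y) \<le> norm y)"

text \<open>The power \<open>h ^ Suc n\<close>, which makes sense without a unit.\<close>

fun power_Suc' :: "'b::semigroup_mult \<Rightarrow> nat \<Rightarrow> 'b" where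
  "power_Suc' h 0 = h"
| "power_Suc' h (Suc n) = h * power_Suc' h n"

lemma power_Suc'_mult: "power_Suc' h i * power_Suc' h j = power_Suc' h (Suc (i + j))"
  by (induction i) (simp_all add: mult.assoc)

lemma power_Suc'_commute:
  assumes "v * h = h * v" shows "v * power_Suc' h n = power_Suc' h n * v"
proof (induction n)
  case (Suc n)
  have "v * power_Suc' h (Suc n) = (v * h) * power_Suc' h n" by (simp add: mult.assoc)
  also have "\<dots> = h * (v * power_Suc' h n)" by (simp add: assms mult.assoc)
  finally show ?case by (simp add: Suc mult.assoc)
qed (simp add: assms)

text \<open>The element \<open>m = 1 - sqrt (1 - h)\<close>: unlike the square root itself, it lies in the algebra.\<close>

lemma one_minus_sqrt_one_minus:
  fixes h :: "'a::cstar_algebra"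
  assumes h: "adj h = h" "norm h \<le> 1"
  obtains m where "adj m = m" "m * m = 2 *\<^sub>R m - h" "\<And>v. v * h = h * v \<Longrightarrow> v * m = m * v"
proof
  define X where "X n = power_Suc' h (n - 1)" for n
  define m where "m = (\<Sum>n. sqrt_coeff n *\<^sub>R X n)"
  have "norm (power_Suc' h n) \<le> 1" for n
  proof (induction n)
    case (Suc n)
    have "norm (power_Suc' h (Suc n)) \<le> norm h * norm (power_Suc' h n)"
      by (simp add: norm_mult_ineq)
    also have "\<dots> \<le> 1" using h(2) Suc by (simp add: mult_le_one)
    finally show ?case .
  qed (use h in simp)
  then have bd: "norm (X n) \<le> 1" for n by (simp add: X_def)
  have "adj (power_Suc' h n) = power_Suc' h n" for n
    by (induction n) (simp_all add: h adj_mult power_Suc'_commute)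
  then show "adj m = m" unfolding m_def by (intro sqrt_series_adj[OF bd]) (simp add: X_def)
  show "v * m = m * v" if "v * h = h * v" for v
    unfolding m_def using that
    by (intro sqrt_series_commute[OF bd]) (simp add: X_def power_Suc'_commute)
  have conv: "(\<Sum>i\<le>n. (sqrt_coeff i * sqrt_coeff (n - i)) *\<^sub>R (X i * X (n - i)))
      = 2 *\<^sub>R (sqrt_coeff n *\<^sub>R X n) - (if n = 1 then X n else 0)" for n
  proof -
    have "(\<Sum>i\<le>n. (sqrt_coeff i * sqrt_coeff (n - i)) *\<^sub>R (X i * X (n - i)))
        = (\<Sum>i\<le>n. (sqrt_coeff i * sqrt_coeff (n - i)) *\<^sub>R X n)"
    proof (rule sum.cong)
      fix i assume "i \<in> {..n}"
      then consider "i = 0" | "i = n" | "0 < i" "i < n" by force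
      then show "(sqrt_coeff i * sqrt_coeff (n - i)) *\<^sub>R (X i * X (n - i))
          = (sqrt_coeff i * sqrt_coeff (n - i)) *\<^sub>R X n"
      proof cases
        case 3
        then obtain a where "i = Suc a" by (cases i) auto
        moreover from 3 obtain b where "n = Suc (i + b)" by (auto simp: less_iff_Suc_add)
        ultimately show ?thesis by (simp add: X_def power_Suc'_mult)
      qed simp_all
    qed simp
    then show ?thesis
      by (simp add: scaleR_sum_left[symmetric] sqrt_coeff_convolution scaleR_diff_left)
  qed
  have "(\<lambda>n. 2 *\<^sub>R (sqrt_coeff n *\<^sub>R X n) - (if n = 1 then X n else 0)) sums (m * m)"
    using sqrt_series_mult_sums[of X 1 X 1, OF bd bd] unfolding conv m_def .
  moreover have "(\<lambda>n. 2 *\<^sub>R (sqrt_coeff n *\<^sub>R X n) - (if n = 1 then X n else 0)) sums (2 *\<^sub>R m - X 1)"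
    unfolding m_def
    by (intro sums_diff sums_scaleR_right summable_sums summable_sqrt_series[OF bd] sums_single)
  ultimately show "m * m = 2 *\<^sub>R m - h" by (simp add: sums_unique2 X_def)
qed

text \<open>If \<open>k = sin \<theta>\<close> and \<open>1 - m = cos \<theta>\<close>, then \<open>1 - m + i k = exp (i\<theta>)\<close> is unitary.\<close>

lemma isometry_one_minus_plus_ii:
  fixes m k y :: "'a::cstar_algebra"
  assumes sa: "adj m = m" "adj k = k" and comm: "k * m = m * k" and mm: "m * m = 2 *\<^sub>R m - k * k"
  shows "norm (y - m * y + \<i> *\<^sub>\<bbbC> (k * y)) = norm y"
proof -
  let ?V = "y - m * y + \<i> *\<^sub>\<bbbC> (k * y)"
  have km: "k * (m * z) = m * (k * z)" for z
    by (metis comm mult.assoc)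
  have mm': "m * (m * z) = 2 *\<^sub>R (m * z) - k * (k * z)" for z
    by (metis mm mult.assoc left_diff_distrib scaleR_left.add mult_scaleR_left)
  have "adj ?V * ?V = adj y * y"
    by (simp add: adj_simps sa cscale_simps algebra_simps km mm' scaleR_2)
  then have "(norm ?V)\<^sup>2 = (norm y)\<^sup>2"
    by (metis cstar_identity)
  then show ?thesis by simp
qed

text \<open>A trigonometric argument: \<open>1 - 2 sin\<^sup>2 \<theta>\<close> is the mean of \<open>exp (2i\<theta>)\<close> and \<open>exp (- 2i\<theta>)\<close>, hence a
contraction, and \<open>1 - sin\<^sup>2 \<theta>\<close> is the mean of that and 1. It replaces the continuous functional
calculus.\<close>

lemma one_minus_contraction_square:
  fixes k :: "'a::cstar_algebra"
  assumes k: "adj k = k" "norm k \<le> 1"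
  shows "one_minus_contraction (k * k)"
  unfolding one_minus_contraction_def
proof
  fix y
  have "adj (k * k) = k * k" by (simp add: adj_mult k)
  moreover have "norm (k * k) \<le> 1"
    by (simp add: norm_square_selfadjoint k power_le_one)
  ultimately obtain m where m: "adj m = m" "m * m = 2 *\<^sub>R m - k * k"
    and "\<And>v. v * (k * k) = (k * k) * v \<Longrightarrow> v * m = m * v"
    using one_minus_sqrt_one_minus by metis
  then have km: "k * m = m * k" by (simp add: mult.assoc)
  have km': "k * (m * z) = m * (k * z)" for z
    by (metis km mult.assoc)
  have mm': "m * (m * z) = 2 *\<^sub>R (m * z) - k * (k * z)" for z
    by (metis m(2) mult.assoc left_diff_distrib scaleR_left.add mult_scaleR_left)
  \<comment> \<open>For \<open>k = sin \<theta>\<close> these are \<open>exp (i\<theta>)\<close> and \<open>exp (- i\<theta>)\<close>, and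
    \<open>exp (2i\<theta>) + exp (- 2i\<theta>) = 2 - 4 sin\<^sup>2 \<theta>\<close>.\<close>
  define V where "V v = v - m * v + \<i> *\<^sub>\<bbbC> (k * v)" for v
  define W where "W v = v - m * v + \<i> *\<^sub>\<bbbC> (- k * v)" for v
  have V: "norm (V v) = norm v" for v
    unfolding V_def using m k km by (intro isometry_one_minus_plus_ii) auto
  have W: "norm (W v) = norm v" for v
    unfolding W_def using m k km by (intro isometry_one_minus_plus_ii) (auto simp: adj_uminus)
  have "V (V y) + W (W y) + 2 *\<^sub>R y = 4 *\<^sub>R (y - (k * k) * y)"
  proof -
    have "V (V y) + W (W y) + 2 *\<^sub>R y
        = (y - (k * k) * y) + (y - (k * k) * y) + (y - (k * k) * y) + (y - (k * k) * y)"
      by (simp add: V_def W_def cscale_simps algebra_simps km' mm' scaleR_2)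
    also have "\<dots> = 4 *\<^sub>R (y - (k * k) * y)"
      using scaleR_add_left[of 2 2 "y - (k * k) * y"] by (simp only: scaleR_2 add.assoc) simp
    finally show ?thesis .
  qed
  then have "4 * norm (y - (k * k) * y) = norm (V (V y) + W (W y) + 2 *\<^sub>R y)"
    by simp
  also have "\<dots> \<le> norm (V (V y)) + norm (W (W y)) + 2 * norm y"
    by (intro norm_triangle_le add_mono norm_triangle_ineq) simp
  finally show "norm (y - k * k * y) \<le> norm y" by (simp add: V W)
qed

lemma one_minus_contraction_scaleR:
  fixes p :: "'a::cstar_algebra"
  assumes p: "one_minus_contraction p" and t: "0 \<le> t" "t \<le> 1"
  shows "one_minus_contraction (t *\<^sub>R p)"
  unfolding one_minus_contraction_def
proof
  fix y
  have "y - (t *\<^sub>R p) * y = (1 - t) *\<^sub>R y + t *\<^sub>R (y - p * y)"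
    by (simp add: algebra_simps)
  also have "norm \<dots> \<le> (1 - t) * norm y + t * norm (y - p * y)"
    using t by (metis abs_of_nonneg diff_ge_0_iff_ge norm_scaleR norm_triangle_ineq)
  also have "\<dots> \<le> (1 - t) * norm y + t * norm y"
    using p t by (intro add_left_mono mult_left_mono) (auto simp: one_minus_contraction_def)
  finally show "norm (y - t *\<^sub>R p * y) \<le> norm y" by (simp add: algebra_simps)
qed

text \<open>The binomial series for \<open>sqrt (1 - (1 - p))\<close>. It converges because \<open>1 - p\<close> is a contraction, and it
inherits the commutant of \<open>p\<close> because it consists of polynomials in \<open>p\<close>.\<close>

lemma positive_sqrt:
  fixes p :: "'a::cstar_algebra"
  assumes p: "adj p = p" "one_minus_contraction p"
  obtains q where "adj q = q" "q * q = p" "one_minus_contraction q"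
    "\<And>v. v * p = p * v \<Longrightarrow> v * q = q * v"
proof
  \<comment> \<open>\<open>e n\<close> is \<open>1 - (1 - p) ^ n\<close>, which lies in the algebra although \<open>1\<close> may not.\<close>
  define e where "e = rec_nat 0 (\<lambda>_ x. x + p - p * x)"
  have e0 [simp]: "e 0 = 0" and eS: "e (Suc n) = e n + p - p * e n" for n
    by (simp_all add: e_def)
  define q where "q = (\<Sum>n. sqrt_coeff n *\<^sub>R e n)"
  have contr: "norm (y - e n * y) \<le> norm y" for n y
  proof (induction n)
    case (Suc n)
    have "y - e (Suc n) * y = (y - e n * y) - p * (y - e n * y)"
      by (simp add: eS algebra_simps)
    then show ?case
      using p(2) Suc by (metis one_minus_contraction_def order_trans)
  qed simp
  have bd: "norm (e n) \<le> 2" for n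
  proof (rule norm_le_if_left_mult_le)
    fix y
    have "norm (e n * y) \<le> norm y + norm (y - e n * y)"
      by (metis diff_diff_eq2 add_diff_cancel_left' norm_triangle_ineq4)
    then show "norm (e n * y) \<le> 2 * norm y" using contr[of y n] by simp
  qed simp
  have comm: "v * e n = e n * v" if "v * p = p * v" for v n
  proof (induction n)
    case (Suc n)
    have "v * (p * e n) = (p * e n) * v"
      by (metis Suc mult.assoc that)
    then show ?case by (simp add: eS algebra_simps Suc that)
  qed simp
  have sa: "adj (e n) = e n" for n
    by (induction n) (simp_all add: eS adj_simps p(1) comm)
  show "adj q = q" unfolding q_def by (rule sqrt_series_adj[OF bd sa])
  show "v * q = q * v" if "v * p = p * v" for v
    unfolding q_def by (rule sqrt_series_commute[OF bd comm[OF that]])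
  have ee: "e i * e j = e i + e j - e (i + j)" for i j
  proof (induction i)
    case (Suc i)
    have "e (Suc i) * e j = e i * e j + p * e j - p * (e i * e j)"
      by (simp add: eS algebra_simps)
    then show ?case by (simp add: Suc eS algebra_simps)
  qed simp
  \<comment> \<open>Expanding the square of the series by \<open>ee\<close>, the convolution identity leaves only the
    term \<open>e 1 = p\<close>.\<close>
  let ?c = "\<lambda>n i. sqrt_coeff i * sqrt_coeff (n - i)"
  have conv: "(\<Sum>i\<le>n. ?c n i *\<^sub>R (e i * e (n - i)))
      = (\<Sum>i\<le>n. ?c n i *\<^sub>R e i) + (\<Sum>i\<le>n. ?c n i *\<^sub>R e (n - i))
        - (2 *\<^sub>R (sqrt_coeff n *\<^sub>R e n) - (if n = 1 then e n else 0))" for n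
  proof -
    have "(\<Sum>i\<le>n. ?c n i *\<^sub>R (e i * e (n - i)))
      = (\<Sum>i\<le>n. ?c n i *\<^sub>R e i + ?c n i *\<^sub>R e (n - i) - ?c n i *\<^sub>R e n)"
      by (rule sum.cong) (auto simp: ee algebra_simps)
    moreover have "(\<Sum>i\<le>n. ?c n i *\<^sub>R e n) = 2 *\<^sub>R (sqrt_coeff n *\<^sub>R e n) - (if n = 1 then e n else 0)"
      by (simp add: scaleR_sum_left[symmetric] sqrt_coeff_convolution scaleR_diff_left)
    ultimately show ?thesis by (simp add: sum.distrib sum_subtractf)
  qed
  have sum_e: "(\<lambda>n. sqrt_coeff n *\<^sub>R e n) sums q"
    unfolding q_def by (intro summable_sums summable_sqrt_series[OF bd])
  have left: "(\<lambda>n. \<Sum>i\<le>n. ?c n i *\<^sub>R e i) sums q"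
    by (rule sqrt_coeff_convolution_vector_sums[OF bd sum_e])
  have right: "(\<lambda>n. \<Sum>i\<le>n. ?c n i *\<^sub>R e (n - i)) sums q"
  proof -
    have "(\<Sum>i\<le>n. ?c n i *\<^sub>R e (n - i)) = (\<Sum>i\<le>n. ?c n i *\<^sub>R e i)" for n
      by (subst sum.nat_diff_reindex[symmetric, of _ "Suc n", simplified lessThan_Suc_atMost])
        (simp add: mult.commute)
    then show ?thesis using left by simp
  qed
  have "(\<lambda>n. \<Sum>i\<le>n. ?c n i *\<^sub>R (e i * e (n - i))) sums (q * q)"
    using sqrt_series_mult_sums[of e 2 e 2, OF bd bd] by (simp add: q_def)
  moreover have "(\<lambda>n. \<Sum>i\<le>n. ?c n i *\<^sub>R (e i * e (n - i))) sums (q + q - (2 *\<^sub>R q - e 1))"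
    unfolding conv by (intro sums_add sums_diff left right sums_scaleR_right sum_e sums_single)
  ultimately have "q * q = q + q - (2 *\<^sub>R q - e 1)" by (rule sums_unique2)
  then show "q * q = p" by (simp add: scaleR_2 eS)
  show "one_minus_contraction q"
    unfolding one_minus_contraction_def
  proof
    fix y
    have "(\<lambda>n. sqrt_coeff n *\<^sub>R y - (sqrt_coeff n *\<^sub>R e n) * y) sums (1 *\<^sub>R y - q * y)"
      using suminf_sqrt_coeff summable_sqrt_coeff
      by (intro sums_diff sums_scaleR_left sums_mult2 sum_e) (simp add: sums_iff)
    then have S: "(\<lambda>n. sqrt_coeff n *\<^sub>R (y - e n * y)) sums (y - q * y)"
      by (simp add: scaleR_diff_right)
    have T: "(\<lambda>n. sqrt_coeff n * norm y) sums (1 * norm y)"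
      using suminf_sqrt_coeff summable_sqrt_coeff
      by (intro sums_mult2) (simp add: sums_iff)
    have "norm (\<Sum>n. sqrt_coeff n *\<^sub>R (y - e n * y)) \<le> (\<Sum>n. sqrt_coeff n * norm y)"
      using contr sqrt_coeff_nonneg
      by (intro norm_suminf_le sums_summable[OF T]) (simp add: mult_left_mono)
    then show "norm (y - q * y) \<le> norm y"
      using S T by (simp add: sums_iff)
  qed
qed

section \<open>Positive elements\<close>

text \<open>Positivity expressed through the norm. Since the norm condition is convex, sums of positive elements
are visibly positive in this form; that \<open>x\<^sup>* x\<close> is positive is what takes work.\<close>

definition positive :: "'a::cstar_algebra \<Rightarrow> bool"
  where "positive h \<longleftrightarrow> adj h = h \<and> (\<exists>t>0. one_minus_contraction (t *\<^sub>R h))"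

lemma positive_common_scale:
  fixes h k :: "'a::cstar_algebra"
  assumes "positive h" and "positive k"
  obtains r where "0 < r" "one_minus_contraction (r *\<^sub>R h)" "one_minus_contraction (r *\<^sub>R k)"
proof -
  obtain s t where s: "0 < s" "one_minus_contraction (s *\<^sub>R h)"
    and t: "0 < t" "one_minus_contraction (t *\<^sub>R k)"
    using assms by (auto simp: positive_def)
  define r where "r = min s t"
  have r: "0 < r" using s t by (simp add: r_def)
  have "one_minus_contraction (r *\<^sub>R h)"
    using one_minus_contraction_scaleR[OF s(2), of "r / s"] s(1) r by (simp add: r_def)
  moreover have "one_minus_contraction (r *\<^sub>R k)"
    using one_minus_contraction_scaleR[OF t(2), of "r / t"] t(1) r by (simp add: r_def)
  ultimately show thesis using r by (intro that[of r])
qed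

lemma positive_add:
  fixes h k :: "'a::cstar_algebra"
  assumes "positive h" and "positive k"
  shows "positive (h + k)"
proof -
  obtain r where r: "0 < r" and h: "one_minus_contraction (r *\<^sub>R h)"
    and k: "one_minus_contraction (r *\<^sub>R k)"
    using positive_common_scale[OF assms] .
  have "norm (y - ((r / 2) *\<^sub>R (h + k)) * y) \<le> norm y" for y
  proof -
    have "2 *\<^sub>R (y - ((r / 2) *\<^sub>R (h + k)) * y) = (y - (r *\<^sub>R h) * y) + (y - (r *\<^sub>R k) * y)"
      by (simp add: algebra_simps scaleR_2)
    then have "2 * norm (y - ((r / 2) *\<^sub>R (h + k)) * y) = norm ((y - (r *\<^sub>R h) * y) + (y - (r *\<^sub>R k) * y))"
      by (metis abs_numeral norm_scaleR)
    also have "\<dots> \<le> norm y + norm y"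
      using h k by (intro norm_triangle_le add_mono) (auto simp: one_minus_contraction_def)
    finally show ?thesis by simp
  qed
  then have "one_minus_contraction ((r / 2) *\<^sub>R (h + k))" by (simp add: one_minus_contraction_def)
  then show ?thesis
    using assms r by (auto simp: positive_def adj_add intro!: exI[of _ "r / 2"])
qed

lemma positive_scaleR:
  fixes h :: "'a::cstar_algebra"
  assumes "positive h" and "0 < r"
  shows "positive (r *\<^sub>R h)"
proof -
  obtain t where t: "0 < t" "one_minus_contraction (t *\<^sub>R h)" "adj h = h"
    using assms by (auto simp: positive_def)
  then have "one_minus_contraction ((t / r) *\<^sub>R (r *\<^sub>R h))" using assms by simp
  then show ?thesis
    using assms t unfolding positive_def adj_scaleR by (metis divide_pos_pos)
qed

lemma positive_square:
  fixes k :: "'a::cstar_algebra"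
  assumes "adj k = k" shows "positive (k * k)"
proof -
  define s where "s = 1 / (norm k + 1)"
  have s: "0 < s" by (simp add: s_def add_nonneg_pos)
  have "norm (s *\<^sub>R k) \<le> 1" by (simp add: s_def divide_simps add_nonneg_pos)
  then have "one_minus_contraction ((s *\<^sub>R k) * (s *\<^sub>R k))"
    using assms by (intro one_minus_contraction_square) (simp_all add: adj_scaleR)
  then have "one_minus_contraction ((s * s) *\<^sub>R (k * k))" by simp
  then show ?thesis
    using assms s unfolding positive_def adj_mult by (metis mult_pos_pos)
qed

text \<open>Write \<open>r h = q\<^sup>2\<close> and \<open>- r h = p\<^sup>2\<close> with commuting self-adjoint square roots, for some \<open>r > 0\<close>. Then
\<open>q + i p\<close> is normal and \<open>(q + i p)\<^sup>* (q + i p) = q\<^sup>2 + p\<^sup>2 = 0\<close>.\<close>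

lemma positive_and_negative_imp_0:
  fixes h :: "'a::cstar_algebra"
  assumes "positive h" and "positive (- h)"
  shows "h = 0"
proof -
  have h: "adj h = h" using assms by (simp add: positive_def)
  obtain r where r: "0 < r" and pos: "one_minus_contraction (r *\<^sub>R h)"
    and neg: "one_minus_contraction (r *\<^sub>R (- h))"
    using positive_common_scale[OF assms] .
  from pos obtain q where q: "adj q = q" "q * q = r *\<^sub>R h"
    and q_comm: "\<And>v. v * (r *\<^sub>R h) = (r *\<^sub>R h) * v \<Longrightarrow> v * q = q * v"
    using positive_sqrt[of "r *\<^sub>R h"] h by (metis adj_scaleR)
  from neg obtain p where p: "adj p = p" "p * p = r *\<^sub>R (- h)"
    using positive_sqrt[of "r *\<^sub>R (- h)"] h by (metis adj_scaleR adj_uminus)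
  have rh: "r *\<^sub>R h = - (p * p)" using p(2) by simp
  have comm: "p * q = q * p"
    by (rule q_comm) (simp add: rh mult.assoc)
  \<comment> \<open>\<open>N\<close> is normal with \<open>N\<^sup>* N = q\<^sup>2 + p\<^sup>2 = 0\<close>, so both its real and its imaginary
    part vanish.\<close>
  let ?N = "q + \<i> *\<^sub>\<bbbC> p"
  have "adj ?N * ?N = q * q + p * p"
    by (simp add: adj_simps p(1) q(1) cscale_simps algebra_simps comm)
  also have "\<dots> = 0" using q(2) rh by simp
  finally have N: "?N = 0" by (rule adj_mult_self_eq_0D)
  then have "adj ?N = 0" by simp
  then have "q - \<i> *\<^sub>\<bbbC> p = 0" by (simp add: adj_simps p(1) q(1) cscale_simps)
  with N have "q + q = 0" by (metis add_0 add_diff_cancel_left' add_uminus_conv_diff diff_add_cancel neg_eq_iff_add_eq_0)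
  then have "2 *\<^sub>R q = 0" by (simp add: scaleR_2)
  then show "h = 0" using q(2) r by simp
qed

lemma power_bounded_linearly_imp_le_1:
  fixes r :: real
  assumes "\<And>m. r ^ (2 ^ m) \<le> 1 + c * 2 ^ m"
  shows "r \<le> 1"
proof (rule ccontr)
  assume "\<not> r \<le> 1"
  then have "1 < r" by simp
  then have "(\<lambda>n. (1 + c * real n) / r ^ n) \<longlonglongrightarrow> 0"
    by real_asymp
  then have "(\<lambda>m. (1 + c * real (2 ^ m)) / r ^ (2 ^ m)) \<longlonglongrightarrow> 0"
    by (rule filterlim_compose) real_asymp
  moreover have "1 \<le> (1 + c * real (2 ^ m)) / r ^ (2 ^ m)" for m
    using assms[of m] \<open>1 < r\<close> by (simp add: divide_simps)
  ultimately have "1 \<le> (0::real)" by (intro LIMSEQ_le_const) auto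
  then show False by simp
qed

text \<open>The heart of the matter is that \<open>x\<^sup>* x\<close> and \<open>x x\<^sup>*\<close> have the same spectrum up to 0, so that \<open>- x x\<^sup>*\<close> is
positive as well. Instead of spectra, norms of powers are compared: the powers of \<open>G = 1 + t x x\<^sup>*\<close>
grow at most linearly because those of \<open>H = 1 + t x\<^sup>* x\<close> are contractions and \<open>G x = x H\<close>; being
self-adjoint, \<open>G\<close> must then be a contraction. As \<open>x x\<^sup>* + x\<^sup>* x\<close> is positive, \<open>x x\<^sup>*\<close> is both positive
and negative, hence 0.\<close>

lemma positive_uminus_adj_mult_self_imp_0:
  fixes x :: "'a::cstar_algebra"
  assumes "positive (- (adj x * x))"
  shows "x = 0"
proof -
  obtain t where t: "0 < t" "one_minus_contraction (t *\<^sub>R (- (adj x * x)))"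
    using assms by (auto simp: positive_def)
  define G where "G v = v + t *\<^sub>R (x * (adj x * v))" for v
  define H where "H v = v + t *\<^sub>R (adj x * (x * v))" for v
  have H: "norm (H v) \<le> norm v" for v
    using t(2) by (simp add: one_minus_contraction_def H_def mult.assoc)
  have Hn: "norm ((H ^^ n) v) \<le> norm v" for n v
    by (induction n) (auto intro: order_trans[OF H])
  \<comment> \<open>This intertwining turns the contraction property of \<open>H\<close> into linear growth of \<open>G ^^ n\<close>.\<close>
  have GH: "G (x * v) = x * H v" for v
    by (simp add: G_def H_def algebra_simps)
  have GHn: "(G ^^ n) (x * v) = x * (H ^^ n) v" for n v
    by (induction n) (simp_all add: GH)
  have G_add: "(G ^^ n) (u + v) = (G ^^ n) u + (G ^^ n) v" for n u v
    by (induction n) (simp_all add: G_def algebra_simps)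
  have growth: "norm ((G ^^ n) y) \<le> (1 + (t * (norm x)\<^sup>2) * real n) * norm y" for n y
  proof (induction n)
    case (Suc n)
    have "(G ^^ Suc n) y = (G ^^ n) (y + x * (t *\<^sub>R (adj x * y)))"
      by (simp add: funpow_swap1 G_def)
    also have "\<dots> = (G ^^ n) y + x * (H ^^ n) (t *\<^sub>R (adj x * y))"
      by (simp add: G_add GHn[symmetric])
    also have "norm \<dots> \<le> (1 + (t * (norm x)\<^sup>2) * real n) * norm y + t * (norm x)\<^sup>2 * norm y"
    proof (rule norm_triangle_le, rule add_mono)
      have "norm (x * (H ^^ n) (t *\<^sub>R (adj x * y))) \<le> norm x * norm (t *\<^sub>R (adj x * y))"
        by (rule order_trans[OF norm_mult_ineq mult_left_mono[OF Hn norm_ge_zero]])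
      also have "\<dots> \<le> norm x * (t * (norm x * norm y))"
        using t(1) norm_mult_ineq[of "adj x" y] by (auto intro!: mult_left_mono)
      finally show "norm (x * (H ^^ n) (t *\<^sub>R (adj x * y))) \<le> t * (norm x)\<^sup>2 * norm y"
        by (simp add: power2_eq_square mult_ac)
    qed (rule Suc)
    finally show ?case by (simp add: algebra_simps)
  qed simp
  have G_adj: "adj ((G ^^ n) u) * v = adj u * (G ^^ n) v" for n u v
  proof (induction n arbitrary: u)
    case (Suc n)
    have "adj (G u) * w = adj u * G w" for w
      by (simp add: G_def adj_simps algebra_simps)
    then show ?case by (simp add: funpow_swap1 Suc)
  qed simp
  \<comment> \<open>Since \<open>G\<close> is self-adjoint, doubling the exponent at least squares the growth factor, so
    any factor above 1 would make the growth exponential.\<close>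
  have double: "(norm ((G ^^ n) y))\<^sup>2 \<le> norm y * norm ((G ^^ (n + n)) y)" for n y
    using norm_mult_ineq[of "adj y" "(G ^^ (n + n)) y"]
    by (simp add: cstar_identity[symmetric] G_adj funpow_add)
  have "norm (G y) \<le> norm y" for y
  proof (cases "y = 0")
    case False
    define r where "r = norm (G y) / norm y"
    have "r ^ (2 ^ m) * norm y \<le> norm ((G ^^ (2 ^ m)) y)" for m
    proof (induction m)
      case (Suc m)
      have "0 \<le> r ^ (2 ^ m) * norm y" by (simp add: r_def)
      then have "(r ^ (2 ^ m) * norm y)\<^sup>2 \<le> norm y * norm ((G ^^ (2 ^ m + 2 ^ m)) y)"
        by (rule order_trans[OF power_mono[OF Suc] double])
      then show ?case using False
        by (simp add: power2_eq_square power_mult_distrib power_add mult_2 mult_ac)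
    qed (use False in \<open>simp add: r_def\<close>)
    from order_trans[OF this growth] False
    have "r ^ (2 ^ m) \<le> 1 + (t * (norm x)\<^sup>2) * 2 ^ m" for m by simp
    then have "r \<le> 1" by (rule power_bounded_linearly_imp_le_1)
    then show ?thesis using False by (simp add: r_def)
  qed (simp add: G_def)
  then have "one_minus_contraction (t *\<^sub>R (- (x * adj x)))"
    by (simp add: one_minus_contraction_def G_def mult.assoc)
  then have neg: "positive (- (x * adj x))"
    using t(1) by (auto simp: positive_def adj_simps)
  \<comment> \<open>The opposite sign comes from \<open>x x\<^sup>* + x\<^sup>* x\<close> being half a sum of two squares of
    self-adjoint elements.\<close>
  let ?k = "x + adj x" and ?l = "\<i> *\<^sub>\<bbbC> (x - adj x)"
  have "positive (?k * ?k + ?l * ?l)"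
    by (intro positive_add positive_square) (simp_all add: adj_simps cscale_simps)
  also have "?k * ?k + ?l * ?l = 2 *\<^sub>R (x * adj x + adj x * x)"
    by (simp add: cscale_simps algebra_simps scaleR_2)
  finally have "positive ((1/2) *\<^sub>R (2 *\<^sub>R (x * adj x + adj x * x)))"
    by (rule positive_scaleR) simp
  then have "positive (x * adj x + adj x * x)" by simp
  from positive_add[OF this assms] have "positive (x * adj x)" by simp
  then have "x * adj x = 0" using neg by (rule positive_and_negative_imp_0)
  then show "x = 0" by (rule mult_adj_self_eq_0D)
qed

text \<open>The negative part of \<open>h = x\<^sup>* x\<close> vanishes: with \<open>r\<close> the square root of \<open>h\<^sup>2\<close> and \<open>k = r - h\<close>,
\<open>(x k)\<^sup>* (x k) = k h k = - k r k\<close> is minus the square of \<open>sqrt r * k\<close>, so \<open>x k = 0\<close> by the previous lemma.\<close>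

lemma adj_mult_self_is_square:
  fixes x :: "'a::cstar_algebra"
  assumes "norm x \<le> 1"
  obtains q where "adj q = q" "adj x * x = q * q"
proof -
  define h where "h = adj x * x"
  have h: "adj h = h" by (simp add: h_def adj_mult adj_adj)
  have "norm h \<le> 1" using assms by (simp add: h_def cstar_identity power_le_one)
  then have "one_minus_contraction (h * h)" by (rule one_minus_contraction_square[OF h])
  moreover have "adj (h * h) = h * h" by (simp add: adj_mult h)
  ultimately obtain r where r: "adj r = r" "r * r = h * h" "one_minus_contraction r"
    and r_comm: "\<And>v. v * (h * h) = (h * h) * v \<Longrightarrow> v * r = r * v"
    using positive_sqrt[of "h * h"] by blast
  have hr: "h * r = r * h" by (rule r_comm) (simp add: mult.assoc)
  obtain q where q: "adj q = q" "q * q = r" and q_comm: "\<And>v. v * r = r * v \<Longrightarrow> v * q = q * v"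
    using positive_sqrt[OF r(1,3)] by blast
  \<comment> \<open>Here \<open>r\<close> is the absolute value of \<open>h\<close>, so \<open>k\<close> is twice its negative part, and the
    aim is \<open>k = 0\<close>.\<close>
  define k where "k = r - h"
  have k: "adj k = k" unfolding k_def using h r(1) by (simp only: adj_diff)
  have rk: "k * r = r * k" unfolding k_def using hr by (simp only: left_diff_distrib right_diff_distrib)
  then have kq: "k * q = q * k" by (rule q_comm)
  have hk: "h * k = - (r * k)"
    unfolding k_def right_diff_distrib hr r(2)[symmetric] by simp
  have "adj (x * k) * (x * k) = k * (h * k)" by (simp add: adj_mult k h_def mult.assoc)
  also have "\<dots> = - ((q * k) * (q * k))"
    unfolding hk by (simp add: q(2)[symmetric] mult.assoc) (metis kq mult.assoc)
  finally have "- (adj (x * k) * (x * k)) = (q * k) * (q * k)" by simp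
  moreover have "positive ((q * k) * (q * k))"
    by (rule positive_square) (simp add: adj_mult k q(1) kq)
  ultimately have "x * k = 0"
    by (intro positive_uminus_adj_mult_self_imp_0) simp
  then have hk0: "h * k = 0" by (simp add: h_def mult.assoc)
  have "adj k * k = r * k - h * k" unfolding k by (simp add: k_def left_diff_distrib)
  also have "\<dots> = 0" using hk0 hk by simp
  finally have "k = 0" by (rule adj_mult_self_eq_0D)
  then have "adj x * x = q * q" by (simp add: k_def h_def q(2))
  with q(1) show ?thesis by (rule that)
qed

lemma one_minus_contraction_adj_mult_self:
  fixes x :: "'a::cstar_algebra"
  assumes "norm x \<le> 1"
  shows "one_minus_contraction (adj x * x)"
proof -
  obtain q where q: "adj q = q" "adj x * x = q * q"
    using adj_mult_self_is_square[OF assms] .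
  have "(norm q)\<^sup>2 = (norm x)\<^sup>2"
    using q cstar_identity[of x] norm_square_selfadjoint[of q] by simp
  then have "norm q \<le> 1" using assms by simp
  then show ?thesis unfolding q(2) by (rule one_minus_contraction_square[OF q(1)])
qed

lemma one_minus_contraction_zero [simp]: "one_minus_contraction (0::'a::cstar_algebra)"
  by (simp add: one_minus_contraction_def)

lemma one_minus_contraction_series:
  fixes p :: "nat \<Rightarrow> 'a::cstar_algebra"
  assumes p: "\<And>n. one_minus_contraction (p n)"
    and s: "(\<lambda>n. (1/2) ^ Suc n *\<^sub>R p n) sums s"
  shows "one_minus_contraction s"
  unfolding one_minus_contraction_def
proof
  fix y
  have "(\<lambda>n. (1/2) ^ Suc n *\<^sub>R y - ((1/2) ^ Suc n *\<^sub>R p n) * y) sums (1 *\<^sub>R y - s * y)"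
    by (intro sums_diff sums_scaleR_left sums_mult2 s power_half_series)
  then have "(\<lambda>n. (1/2) ^ Suc n *\<^sub>R (y - p n * y)) sums (y - s * y)"
    by (simp add: scaleR_diff_right)
  moreover have "(\<lambda>n. (1/2) ^ Suc n * norm y) sums (1 * norm y)"
    by (intro sums_mult2 power_half_series)
  moreover have "norm ((1/2) ^ Suc n *\<^sub>R (y - p n * y)) \<le> (1/2) ^ Suc n * norm y" for n
    using p[of n] by (simp add: one_minus_contraction_def)
  ultimately have "norm (y - s * y) \<le> 1 * norm y" by (rule norm_sums_le)
  then show "norm (y - s * y) \<le> norm y" by simp
qed

text \<open>The negative of any one summand is the sum of the others, hence positive.\<close>

lemma adj_mult_self_series_eq_0D:
  fixes v :: "nat \<Rightarrow> 'a::cstar_algebra"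
  assumes v: "\<And>n. norm (v n) \<le> 1"
    and zero: "(\<lambda>n. (1/2) ^ Suc n *\<^sub>R (adj (v n) * v n)) sums 0"
  shows "v m = 0"
proof -
  let ?p = "\<lambda>n. adj (v n) * v n"
  let ?s = "(1/2) ^ Suc m *\<^sub>R ?p m"
  have "(\<lambda>n. (1/2) ^ Suc n *\<^sub>R ?p n - (if n = m then (1/2) ^ Suc n *\<^sub>R ?p n else 0)) sums (0 - ?s)"
    by (intro sums_diff zero sums_single)
  also have "(\<lambda>n. (1/2) ^ Suc n *\<^sub>R ?p n - (if n = m then (1/2) ^ Suc n *\<^sub>R ?p n else 0))
      = (\<lambda>n. (1/2) ^ Suc n *\<^sub>R (if n = m then 0 else ?p n))" by auto
  finally have "(\<lambda>n. (1/2) ^ Suc n *\<^sub>R (if n = m then 0 else ?p n)) sums (- ?s)" by simp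
  then have "one_minus_contraction (- ?s)"
    by (rule one_minus_contraction_series[rotated]) (simp add: one_minus_contraction_adj_mult_self v)
  then have "one_minus_contraction ((1/2) ^ Suc m *\<^sub>R (- ?p m))" by simp
  moreover have "adj (- ?p m) = - ?p m" by (simp add: adj_simps)
  moreover have "0 < (1/2 :: real) ^ Suc m" by simp
  ultimately have "positive (- ?p m)" unfolding positive_def by blast
  then show ?thesis by (rule positive_uminus_adj_mult_self_imp_0)
qed

section \<open>Generators of annihilators\<close>

text \<open>The generator is a weighted sum of the elements \<open>x\<^sub>n\<^sup>* x\<^sub>n\<close>; positivity forbids cancellation between them.\<close>

lemma common_kernel_of_sequence:
  fixes x :: "nat \<Rightarrow> 'a::cstar_algebra"
  obtains z where "adj z = z" "\<And>y. z * y = 0 \<longleftrightarrow> (\<forall>n. x n * y = 0)"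
proof
  define u where "u n = (1 / (norm (x n) + 1)) *\<^sub>R x n" for n
  have pos: "0 < norm w + 1" for w :: 'a by (simp add: add_nonneg_pos)
  have u: "norm (u n) \<le> 1" for n
    using pos[of "x n"] by (simp add: u_def divide_simps)
  define z where "z = (\<Sum>n. (1/2) ^ Suc n *\<^sub>R (adj (u n) * u n))"
  have "summable (\<lambda>n. (1/2) ^ Suc n *\<^sub>R (adj (u n) * u n))"
  proof (rule summable_comparison_test')
    show "summable (\<lambda>n. (1/2 :: real) ^ Suc n)" by (rule sums_summable[OF power_half_series])
    show "norm ((1/2) ^ Suc n *\<^sub>R (adj (u n) * u n)) \<le> (1/2) ^ Suc n" for n
      using u[of n] by (simp add: cstar_identity power_le_one)
  qed
  then have z: "(\<lambda>n. (1/2) ^ Suc n *\<^sub>R (adj (u n) * u n)) sums z"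
    unfolding z_def by (rule summable_sums)
  have "(\<lambda>n. adj ((1/2) ^ Suc n *\<^sub>R (adj (u n) * u n))) sums adj z"
    by (rule bounded_linear.sums[OF bounded_linear_adj z])
  then show "adj z = z" using z by (simp add: adj_simps sums_unique2)
  show "z * y = 0 \<longleftrightarrow> (\<forall>n. x n * y = 0)" for y
  proof
    assume zy: "z * y = 0"
    define c where "c = 1 / (norm y + 1)"
    define y' where "y' = c *\<^sub>R y"
    have c: "0 < c" using pos[of y] by (simp add: c_def)
    have y': "norm y' \<le> 1" using pos[of y] by (simp add: y'_def c_def divide_simps)
    have "(\<lambda>n. adj y' * (((1/2) ^ Suc n *\<^sub>R (adj (u n) * u n)) * y')) sums (adj y' * (z * y'))"
      by (intro sums_mult sums_mult2 z)
    then have "(\<lambda>n. (1/2) ^ Suc n *\<^sub>R (adj (u n * y') * (u n * y'))) sums 0"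
      using zy by (simp add: y'_def adj_simps mult.assoc mult_ac)
    moreover have "norm (u n * y') \<le> 1" for n
      by (rule order_trans[OF norm_mult_ineq]) (simp add: mult_le_one u y')
    ultimately have "u n * y' = 0" for n
      by (intro adj_mult_self_series_eq_0D[of "\<lambda>n. u n * y'"])
    then show "\<forall>n. x n * y = 0" using c pos by (simp add: u_def y'_def less_imp_neq[symmetric])
  next
    assume "\<forall>n. x n * y = 0"
    then have "u n * y = 0" for n by (simp add: u_def)
    then have "(\<lambda>n. 0) sums (z * y)"
      using sums_mult2[OF z, of y] by (simp add: mult.assoc)
    then show "z * y = 0" by (rule sums_unique2) (rule sums_zero)
  qed
qed

lemma ann_memI: "(\<And>s. s \<in> S \<Longrightarrow> s * b = 0 \<and> s * adj b = 0) \<Longrightarrow> b \<in> ann S"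
  by (simp add: ann_def perp_def)

text \<open>This reduces everything to right kernels: \<open>{x}\<^sup>\<bottom>\<^sup>\<bottom>\<close> is determined by \<open>{v. x v = 0}\<close>, in an
order-reversing way. Equality of kernels is therefore all that equivalence of annihilators asks for.\<close>

lemma bi_annihilator_subset_iff:
  fixes x y :: "'a::cstar_algebra"
  shows "ann (ann {x}) \<subseteq> ann (ann {y}) \<longleftrightarrow> (\<forall>v. y * v = 0 \<longrightarrow> x * v = 0)"
proof
  assume R: "\<forall>v. y * v = 0 \<longrightarrow> x * v = 0"
  then have "ann {y} \<subseteq> ann {x}" by (auto simp: ann_def perp_def)
  then show "ann (ann {x}) \<subseteq> ann (ann {y})" by (auto simp: ann_def)
next
  assume L: "ann (ann {x}) \<subseteq> ann (ann {y})"
  show "\<forall>v. y * v = 0 \<longrightarrow> x * v = 0"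
  proof (intro allI impI)
    fix v assume yv: "y * v = 0"
    \<comment> \<open>Passing to \<open>v v\<^sup>*\<close> turns a one-sided kernel condition into the two-sided one that
      defines annihilators.\<close>
    then have v: "v * adj v \<in> ann {y}"
      by (auto intro!: ann_memI simp: adj_simps simp flip: mult.assoc)
    have "adj x * x \<in> ann (ann {x})"
    proof (rule ann_memI)
      fix b assume "b \<in> ann {x}"
      then have "x * adj b = 0" by (simp add: ann_def perp_def)
      then have "adj (x * adj b) = 0" by simp
      then have "b * adj x = 0" by (simp add: adj_simps)
      then show "b * (adj x * x) = 0 \<and> b * adj (adj x * x) = 0"
        by (simp add: adj_simps flip: mult.assoc)
    qed
    with L v have "(v * adj v) * (adj x * x) = 0" by (auto simp: ann_def perp_def)
    then have "adj ((v * adj v) * (adj x * x)) = 0" by simp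
    then have "adj x * (x * (v * adj v)) = 0" by (simp add: adj_simps mult.assoc)
    then show "x * v = 0" by (simp add: adj_mult_cancel mult_self_adj_cancel)
  qed
qed

lemma bi_annihilator_eq_iff:
  fixes x y :: "'a::cstar_algebra"
  shows "ann (ann {x}) = ann (ann {y}) \<longleftrightarrow> (\<forall>v. x * v = 0 \<longleftrightarrow> y * v = 0)"
  by (simp add: set_eq_subset bi_annihilator_subset_iff) blast

text \<open>The element \<open>z\<close> generates the orthocomplement of the annihilator spanned by the left supports of the
members of \<open>W\<close>. The last property says that what \<open>z\<close> kills lies in that annihilator and is therefore
orthogonal to everything killed by all the \<open>w\<^sup>*\<close>. Anniseparability presents the
annihilator as the common kernel of countably many elements, which can be merged into one.\<close>

lemma orthocomplement_generator:
  fixes W :: "'a::cstar_algebra set"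
  assumes "anniseparable TYPE('a)"
  obtains z where "adj z = z" "\<And>w. w \<in> W \<Longrightarrow> z * w = 0"
    "\<And>y v. z * y = 0 \<Longrightarrow> (\<And>w. w \<in> W \<Longrightarrow> adj w * v = 0) \<Longrightarrow> adj v * y = 0"
proof -
  let ?S = "ann (ann (adj ` W))"
  have "?S \<in> annihilators" by (simp add: annihilators_def)
  then obtain T where T: "countable T" "?S = ann T"
    using assms unfolding anniseparable_def by blast
  obtain z where z: "adj z = z"
    and ker: "\<And>y. z * y = 0 \<longleftrightarrow> (\<forall>n. from_nat_into (insert 0 T) n * y = 0)"
    using common_kernel_of_sequence[of "from_nat_into (insert 0 T)"] by blast
  have "range (from_nat_into (insert 0 T)) = insert 0 T"
    using T(1) by (intro range_from_nat_into) auto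
  then have kerT: "z * y = 0 \<longleftrightarrow> (\<forall>t\<in>T. t * y = 0)" for y
    unfolding ker by (metis (no_types, lifting) insert_iff mult_zero_left rangeE rangeI)
  show thesis
  proof
    show "adj z = z" by (rule z)
  next
    fix w assume w: "w \<in> W"
    have "w * adj w \<in> ?S"
    proof (rule ann_memI)
      fix v assume "v \<in> ann (adj ` W)"
      with w have "adj w * adj v = 0" by (auto simp: ann_def perp_def)
      then have "adj (adj w * adj v) = 0" by simp
      then have "v * w = 0" by (simp add: adj_simps)
      then show "v * (w * adj w) = 0 \<and> v * adj (w * adj w) = 0"
        by (simp add: adj_simps flip: mult.assoc)
    qed
    then have "\<forall>t\<in>T. t * (w * adj w) = 0" unfolding T(2) by (simp add: ann_def perp_def)
    then show "z * w = 0" by (simp add: kerT mult_self_adj_cancel)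
  next
    fix y v assume y: "z * y = 0" and v: "\<And>w. w \<in> W \<Longrightarrow> adj w * v = 0"
    have "y * adj y \<in> ?S"
      unfolding T(2) using y by (intro ann_memI) (simp add: kerT adj_simps flip: mult.assoc)
    moreover have "v * adj v \<in> ann (adj ` W)"
      using v by (intro ann_memI) (auto simp: adj_simps simp flip: mult.assoc)
    ultimately have "(v * adj v) * (y * adj y) = 0" by (simp add: ann_def perp_def)
    then have "(v * adj v) * y = 0" by (simp only: mult_self_adj_cancel)
    then have "adj (adj v) * (adj v * y) = 0" by (simp add: mult.assoc adj_adj)
    then show "adj v * y = 0" by (simp add: adj_mult_cancel)
  qed
qed

section \<open>The Schroeder-Bernstein argument\<close>

text \<open>The defect \<open>P\<close> of \<open>b\<close>, carried into the annihilator generated by \<open>b\<close> by \<open>a\<close>, and then moved on by the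
powers of \<open>a b\<close>. Here \<open>z\<close> generates the complement of the left support of \<open>b\<close>, and \<open>P\<close> is the left
support of \<open>z a\<^sup>* a\<close>.\<close>

fun copies :: "'a::cstar_algebra \<Rightarrow> 'a \<Rightarrow> 'a \<Rightarrow> nat \<Rightarrow> 'a" where
  "copies a b z 0 = a * (adj a * (a * z))"
| "copies a b z (Suc n) = a * (b * copies a b z n)"

lemma norm_copies_le:
  assumes "norm (a * b) \<le> 1/2"
  shows "norm (copies a b z n) \<le> (1/2) ^ n * norm (copies a b z 0)"
proof (induction n)
  case (Suc n)
  have "norm (copies a b z (Suc n)) \<le> norm (a * b) * norm (copies a b z n)"
    by (metis copies.simps(2) mult.assoc norm_mult_ineq)
  also have "\<dots> \<le> 1/2 * ((1/2) ^ n * norm (copies a b z 0))"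
    using assms Suc by (intro mult_mono) auto
  finally show ?case by simp
qed simp

lemma summable_copies_mult:
  assumes ab: "norm (a * b) \<le> 1/2" and q: "Bseq q"
  shows "summable (\<lambda>n. copies a b z n * q n)"
proof -
  obtain K where K: "0 < K" "\<And>n. norm (q n) \<le> K"
    using q by (auto elim: BseqE)
  show ?thesis
  proof (rule summable_comparison_test')
    show "summable (\<lambda>n. (1/2) ^ n * (norm (copies a b z 0) * K))"
      by (intro summable_mult2 summable_geometric) simp
    fix n
    have "norm (copies a b z n * q n) \<le> norm (copies a b z n) * norm (q n)"
      by (rule norm_mult_ineq)
    also have "\<dots> \<le> ((1/2) ^ n * norm (copies a b z 0)) * K"
      using K norm_copies_le[OF ab] by (intro mult_mono) auto
    finally show "norm (copies a b z n * q n) \<le> (1/2) ^ n * (norm (copies a b z 0) * K)"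
      by (simp add: mult.assoc)
  qed
qed

lemma copies_series_head:
  assumes ab: "norm (a * b) \<le> 1/2" and q: "Bseq q"
  shows "(\<Sum>n. copies a b z n * q n)
    = a * (adj a * (a * (z * q 0)) + b * (\<Sum>n. copies a b z n * q (Suc n)))"
proof -
  have q': "Bseq (\<lambda>n. q (Suc n))" using q by (simp add: Bseq_Suc_iff)
  note s = summable_copies_mult[OF ab q, of z] and s' = summable_copies_mult[OF ab q', of z]
  have "(\<Sum>n. copies a b z n * q n) = copies a b z 0 * q 0 + (\<Sum>n. copies a b z (Suc n) * q (Suc n))"
    using suminf_split_head[OF s] by simp
  also have "(\<Sum>n. copies a b z (Suc n) * q (Suc n)) = (\<Sum>n. a * (b * (copies a b z n * q (Suc n))))"
    by (simp add: mult.assoc)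
  also have "\<dots> = a * (b * (\<Sum>n. copies a b z n * q (Suc n)))"
    using s' by (simp add: suminf_mult summable_mult)
  finally show ?thesis by (simp add: mult.assoc distrib_left)
qed

text \<open>The row with entries \<open>copies a b z n\<close> is injective on sequences in \<open>P\<close>. One splits off the first
entry: what remains is \<open>a b\<close> applied to the row with shifted entries, \<open>a\<close> is injective where
needed, and \<open>z\<close> separates the first entry from the range of \<open>b\<close>. The copies need not be orthogonal
for this argument.\<close>

lemma copies_independent:
  fixes a b z :: "'a::cstar_algebra"
  assumes ab: "norm (a * b) \<le> 1/2"
    and ker_a: "\<And>v. a * v = 0 \<Longrightarrow> adj b * v = 0"
    and ker_b: "\<And>v. b * v = 0 \<Longrightarrow> adj a * v = 0"
    and z: "adj z = z" "z * b = 0"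
    and q: "Bseq q" and zero: "(\<Sum>n. copies a b z n * q n) = 0"
  shows "a * (z * q n) = 0"
  using q zero
proof (induction n arbitrary: q)
  have step: "a * (z * q 0) = 0 \<and> (\<Sum>n. copies a b z n * q (Suc n)) = 0"
    if q: "Bseq q" and zero: "(\<Sum>n. copies a b z n * q n) = 0" for q
  proof -
    define X where "X = (\<Sum>n. copies a b z n * q (Suc n))"
    define V where "V = adj a * (a * (z * q 0)) + b * X"
    \<comment> \<open>\<open>V\<close> lies in the range of \<open>a\<^sup>* a\<close> plus that of \<open>b\<close>, on which \<open>a\<close> is injective.\<close>
    have aV: "a * V = 0"
      using zero copies_series_head[OF ab q] by (simp add: V_def X_def)
    have "adj V * V = adj (a * (z * q 0)) * (a * V) + adj X * (adj b * V)"
      by (simp add: V_def adj_simps algebra_simps)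
    also have "\<dots> = 0" using aV ker_a[OF aV] by simp
    finally have V: "V = 0" by (rule adj_mult_self_eq_0D)
    \<comment> \<open>Since \<open>z\<close> kills the range of \<open>b\<close>, it separates the two summands of \<open>V\<close>.\<close>
    have "z * V = z * (adj a * (a * (z * q 0)))"
      by (simp add: V_def distrib_left mult.assoc[symmetric, of z b] z(2))
    then have "adj (a * (z * q 0)) * (a * (z * q 0)) = 0"
      using V z(1) by (simp add: adj_simps mult.assoc)
    then have head: "a * (z * q 0) = 0" by (rule adj_mult_self_eq_0D)
    then have "b * X = 0" using V by (simp add: V_def)
    then have "adj a * X = 0" by (rule ker_b)
    moreover obtain Y where Y: "X = a * Y"
      using copies_series_head[OF ab, of "\<lambda>n. q (Suc n)" z] q by (auto simp: X_def Bseq_Suc_iff)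
    ultimately have "X = 0" by (simp add: adj_mult_cancel)
    with head show ?thesis by (simp add: X_def)
  qed
  {
    case 0
    then show ?case using step by blast
  next
    case (Suc n)
    then show ?case using step[OF Suc.prems] Suc.IH[of "\<lambda>n. q (Suc n)"] by (simp add: Bseq_Suc_iff)
  }
qed

lemma adj_copies_factor:
  assumes "adj z = z"
  shows "\<exists>r. adj (copies a b z n) * p = z * (adj a * (a * r))"
proof (induction n arbitrary: p)
  case 0
  show ?case using assms by (auto simp: adj_simps mult.assoc)
next
  case (Suc n)
  then show ?case by (simp add: adj_simps mult.assoc)
qed

text \<open>The element \<open>u\<close> sends the defect to copy 0, copy \<open>n\<close> to copy \<open>n + 1\<close> (the sum \<open>s\<close>), and acts as
a positive element on the complement of all copies (the term with \<open>f\<close>). Each of these maps is applied after \<open>b\<^sup>*\<close> or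
\<open>z a\<^sup>* a\<close>, which together are injective on the annihilator generated by \<open>a\<close>. Injectivity of \<open>u\<close> and of
its adjoint is read off by first applying \<open>f\<close> or \<open>z\<close>, which isolates one summand, and then using the
independence of the copies. The bound on \<open>a b\<close> makes the series converge.\<close>

lemma schroeder_bernstein_small:
  fixes a b :: "'a::cstar_algebra"
  assumes sep: "anniseparable TYPE('a)"
    and ab: "norm (a * b) \<le> 1/2"
    and ker_a: "\<And>v. a * v = 0 \<Longrightarrow> adj b * v = 0"
    and ker_b: "\<And>v. b * v = 0 \<Longrightarrow> adj a * v = 0"
  obtains u where "\<And>v. u * v = 0 \<longleftrightarrow> a * v = 0" "\<And>v. adj u * v = 0 \<longleftrightarrow> b * v = 0"
proof -
  obtain z where z: "adj z = z" "z * b = 0"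
    and z_compl: "\<And>y v. z * y = 0 \<Longrightarrow> adj b * v = 0 \<Longrightarrow> adj v * y = 0"
    using orthocomplement_generator[OF sep, of "{b}"] by auto
  define w where "w = copies a b z"
  obtain f where f: "adj f = f" "\<And>x. x \<in> range w \<Longrightarrow> f * x = 0"
    and f_compl: "\<And>y v. f * y = 0 \<Longrightarrow> (\<And>x. x \<in> range w \<Longrightarrow> adj x * v = 0) \<Longrightarrow> adj v * y = 0"
    by (rule orthocomplement_generator[OF sep, of "range w"]) blast
  note summable_w = summable_copies_mult[OF ab, of _ z, folded w_def]
  note w_head = copies_series_head[OF ab, of _ z, folded w_def]
  have w_indep: "a * (z * q n) = 0" if "Bseq q" "(\<Sum>n. w n * q n) = 0" for q n
    using ab ker_a ker_b z that unfolding w_def by (rule copies_independent)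
  have w_adj_kernel: "a * (z * (adj (w n) * p)) = 0 \<longleftrightarrow> adj (w n) * p = 0" for n p
  proof
    assume zero: "a * (z * (adj (w n) * p)) = 0"
    obtain r where r: "adj (w n) * p = z * (adj a * (a * r))"
      using adj_copies_factor[OF z(1)] unfolding w_def by blast
    have "adj (z * adj a) * ((z * adj a) * (a * r)) = 0"
      using zero z(1) by (simp add: r adj_simps mult.assoc)
    from adj_mult_cancel[THEN iffD1, OF this] show "adj (w n) * p = 0" by (simp add: r mult.assoc)
  qed simp
  have norm_w_le: "norm (w n) \<le> norm (w 0)" for n
  proof -
    have "norm (w n) \<le> (1/2) ^ n * norm (w 0)" unfolding w_def by (rule norm_copies_le[OF ab])
    also have "\<dots> \<le> norm (w 0)" by (simp add: mult_left_le_one_le power_le_one)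
    finally show ?thesis .
  qed
  have w_adj_bseq: "Bseq (\<lambda>n. adj (w (h n)) * p)" for h p
  proof (rule BseqI')
    show "norm (adj (w (h n)) * p) \<le> norm (w 0) * norm p" for n
      by (rule order_trans[OF norm_mult_ineq]) (simp add: mult_right_mono norm_w_le)
  qed
  \<comment> \<open>The shift from each copy to the next.\<close>
  define s where "s = (\<Sum>n. w (Suc n) * adj (w n))"
  have summable_s: "summable (\<lambda>n. w (Suc n) * adj (w n))"
  proof -
    define q where "q n = (case n of 0 \<Rightarrow> 0 | Suc n \<Rightarrow> adj (w n))" for n
    have "Bseq q"
      by (rule BseqI'[of _ "norm (w 0)"]) (auto simp: q_def norm_w_le split: nat.split)
    from summable_w[OF this] have "summable (\<lambda>n. w (Suc n) * q (Suc n))"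
      by (subst summable_Suc_iff[of "\<lambda>n. w n * q n"])
    then show ?thesis by (simp add: q_def)
  qed
  have s_mult: "s * p = (\<Sum>n. w (Suc n) * (adj (w n) * p))" for p
    using suminf_mult2[OF summable_s, of p] by (simp add: s_def mult.assoc)
  have adj_s_mult: "adj s * p = (\<Sum>n. w n * (adj (w (Suc n)) * p))" for p
  proof -
    have "adj s = (\<Sum>n. w n * adj (w (Suc n)))"
      using bounded_linear.suminf[OF bounded_linear_adj summable_s] by (simp add: s_def adj_simps)
    moreover have "summable (\<lambda>n. w n * adj (w (Suc n)))"
      using bounded_linear.summable[OF bounded_linear_adj summable_s] by (simp add: adj_simps)
    ultimately show ?thesis by (simp add: suminf_mult2 mult.assoc)
  qed
  have f_series: "f * (\<Sum>n. w n * q n) = 0" if "summable (\<lambda>n. w n * q n)" for q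
    using suminf_mult[OF that, of f] f(2)[OF rangeI] by (simp flip: mult.assoc)
  \<comment> \<open>The part of \<open>u\<close> that acts on the complement of all copies; \<open>b\<^sup>* b\<close> generates the same
    annihilator as \<open>b\<close>, and \<open>f\<close> compresses it to that complement.\<close>
  define F where "F p = adj b * (b * (f * (f * (adj b * (b * p)))))" for p
  have F_kernel: "f * (adj b * (b * p)) = 0" if "f * F p = 0" for p
  proof -
    have "adj (b * f) * ((b * f) * (f * (adj b * (b * p)))) = 0"
      using that f(1) by (simp add: F_def adj_simps mult.assoc)
    from adj_mult_cancel[THEN iffD1, OF this] have "b * (f * (f * (adj b * (b * p)))) = 0" by (simp add: mult.assoc)
    then have "adj (f * (adj b * b)) * ((f * (adj b * b)) * p) = 0"
      using f(1) by (simp add: adj_simps mult.assoc)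
    from adj_mult_cancel[THEN iffD1, OF this] show ?thesis by (simp add: mult.assoc)
  qed
  have w_total: "b * p = 0" if "f * (adj b * (b * p)) = 0" "\<And>n. adj (w n) * p = 0" for p
  proof -
    have "adj p * (adj b * (b * p)) = 0"
      using that(2) by (intro f_compl[OF that(1)]) auto
    then have "adj (b * p) * (b * p) = 0" by (simp add: adj_mult mult.assoc)
    then show ?thesis by (rule adj_mult_self_eq_0D)
  qed
  define u where "u = w 0 * (z * (adj a * a)) + s * adj b + adj b * (b * (f * (f * (adj b * (b * adj b)))))"
  have u: "u * v = w 0 * (z * (adj a * (a * v))) + s * (adj b * v) + F (adj b * v)" for v
    by (simp add: u_def F_def algebra_simps)
  have adj_u: "adj u * p = adj a * (a * (z * (adj (w 0) * p))) + b * (adj s * p + F p)" for p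
    by (simp add: u_def F_def adj_simps z(1) f(1) algebra_simps)
  show thesis
  proof
    fix v
    show "u * v = 0 \<longleftrightarrow> a * v = 0"
    proof
      assume uv: "u * v = 0"
      define p where "p = adj b * v"
      \<comment> \<open>The shifted sequence: the defect enters at 0 and every copy moves up by one.\<close>
      define q where "q n = (case n of 0 \<Rightarrow> z * (adj a * (a * v)) | Suc n \<Rightarrow> adj (w n) * p)" for n
      have q: "Bseq q"
        using w_adj_bseq[of "\<lambda>n. n" p] by (subst Bseq_Suc_iff[symmetric]) (simp add: q_def)
      have series: "(\<Sum>n. w n * q n) = w 0 * (z * (adj a * (a * v))) + s * p"
        using suminf_split_head[OF summable_w[OF q]] by (simp add: q_def s_mult)
      have "f * (u * v) = f * (\<Sum>n. w n * q n) + f * F p"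
        by (simp add: u series p_def distrib_left)
      then have "f * F p = 0" using uv f_series[OF summable_w[OF q]] by simp
      then have fp: "f * (adj b * (b * p)) = 0" by (rule F_kernel)
      then have "(\<Sum>n. w n * q n) = 0" using uv by (simp add: u series F_def flip: p_def)
      note zero = w_indep[OF q this]
      have "adj (w n) * p = 0" for n
        using zero[of "Suc n"] by (simp add: q_def w_adj_kernel)
      with fp have "b * p = 0" by (rule w_total)
      then have bv: "adj b * v = 0" unfolding p_def using adj_mult_cancel[of "adj b" v] by (simp add: adj_adj)
      have "adj (z * adj a) * ((z * adj a) * (a * v)) = 0"
        using zero[of 0] z(1) by (simp add: q_def adj_simps mult.assoc)
      from adj_mult_cancel[THEN iffD1, OF this] have "z * (adj a * (a * v)) = 0" by (simp add: mult.assoc)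
      then have "adj v * (adj a * (a * v)) = 0" using bv by (rule z_compl)
      then have "adj (a * v) * (a * v) = 0" by (simp add: adj_mult mult.assoc)
      then show "a * v = 0" by (rule adj_mult_self_eq_0D)
    next
      assume av: "a * v = 0"
      then show "u * v = 0" using ker_a[OF av] by (simp add: u F_def)
    qed
  next
    fix p
    have sum': "summable (\<lambda>n. w n * (adj (w (Suc n)) * p))"
      by (intro summable_w w_adj_bseq)
    show "adj u * p = 0 \<longleftrightarrow> b * p = 0"
    proof
      assume up: "adj u * p = 0"
      define V where "V = adj s * p + F p"
      have "z * (adj u * p) = z * (adj a * (a * (z * (adj (w 0) * p))))"
        by (simp add: adj_u distrib_left mult.assoc[symmetric, of z b] z(2))
      then have "adj (a * z) * ((a * z) * (adj (w 0) * p)) = 0"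
        using up z(1) by (simp add: adj_simps mult.assoc)
      from adj_mult_cancel[THEN iffD1, OF this] have w0z: "a * (z * (adj (w 0) * p)) = 0" by (simp add: mult.assoc)
      then have w0: "adj (w 0) * p = 0" by (simp add: w_adj_kernel)
      have bV: "b * V = 0" using up w0 by (simp add: adj_u V_def)
      then have aV: "adj a * V = 0" by (rule ker_b)
      obtain Y where Y: "adj s * p = a * Y"
        using w_head[OF w_adj_bseq[of Suc p]] by (auto simp: adj_s_mult)
      have "adj V * V = adj Y * (adj a * V) + adj (b * (f * (f * (adj b * (b * p))))) * (b * V)"
        unfolding V_def Y F_def by (simp add: adj_simps algebra_simps)
      also have "\<dots> = 0" by (simp add: aV bV)
      finally have V: "V = 0" by (rule adj_mult_self_eq_0D)
      have "f * (adj s * p) = 0" unfolding adj_s_mult using f_series[OF sum'] .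
      then have "f * F p = 0" using arg_cong[OF V, of "\<lambda>x. f * x"] by (simp add: V_def distrib_left)
      then have fp: "f * (adj b * (b * p)) = 0" by (rule F_kernel)
      then have "(\<Sum>n. w n * (adj (w (Suc n)) * p)) = 0"
        using V by (simp add: V_def F_def adj_s_mult)
      then have "adj (w (Suc n)) * p = 0" for n
        using w_indep[OF w_adj_bseq[of Suc p]] by (simp add: w_adj_kernel)
      then have "adj (w n) * p = 0" for n using w0 by (cases n) auto
      with fp show "b * p = 0" by (rule w_total)
    next
      assume bp: "b * p = 0"
      then have "adj a * p = 0" by (rule ker_b)
      then have "adj (w n) * p = 0" for n
        unfolding w_def by (cases n) (simp_all add: adj_simps mult.assoc)
      with bp show "adj u * p = 0" by (simp add: adj_u adj_s_mult F_def)
    qed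
  qed
qed

lemma schroeder_bernstein_kernels:
  fixes a b :: "'a::cstar_algebra"
  assumes sep: "anniseparable TYPE('a)"
    and ker_a: "\<And>v. a * v = 0 \<Longrightarrow> adj b * v = 0"
    and ker_b: "\<And>v. b * v = 0 \<Longrightarrow> adj a * v = 0"
  obtains u where "\<And>v. u * v = 0 \<longleftrightarrow> a * v = 0" "\<And>v. adj u * v = 0 \<longleftrightarrow> b * v = 0"
proof -
  define c where "c = 1 / (2 * (norm (a * b) + 1))"
  have c: "0 < c" by (simp add: c_def add_nonneg_pos)
  have "0 < norm (a * b) + 1" by (simp add: add_nonneg_pos)
  then have "norm (a * (c *\<^sub>R b)) \<le> 1/2" by (simp add: c_def divide_simps)
  moreover have "adj (c *\<^sub>R b) * v = 0" if "a * v = 0" for v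
    using ker_a[OF that] by (simp add: adj_scaleR)
  moreover have "adj a * v = 0" if "(c *\<^sub>R b) * v = 0" for v
    using that c by (intro ker_b) simp
  ultimately obtain u where "\<And>v. u * v = 0 \<longleftrightarrow> a * v = 0" "\<And>v. adj u * v = 0 \<longleftrightarrow> (c *\<^sub>R b) * v = 0"
    using schroeder_bernstein_small[OF sep, of a "c *\<^sub>R b"] by blast
  then show thesis using c by (intro that[of u]) auto
qed

theorem theorem3p46:
  fixes B C :: "'a::cstar_algebra set"
  assumes "anniseparable TYPE('a)"
    and "B \<in> annihilators" and "C \<in> annihilators"
    and "B \<lesssim>\<^sub>a C" and "C \<lesssim>\<^sub>a B"
  shows "B \<sim>\<^sub>a C"
proof -
  obtain a where a: "ann (ann {a}) = B" "ann (ann {adj a}) \<subseteq> C"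
    using assms(4) by (auto simp: ann_subequiv_def ann_equiv_def)
  obtain b where b: "ann (ann {b}) = C" "ann (ann {adj b}) \<subseteq> B"
    using assms(5) by (auto simp: ann_subequiv_def ann_equiv_def)
  have "ann (ann {adj b}) \<subseteq> ann (ann {a})" and "ann (ann {adj a}) \<subseteq> ann (ann {b})"
    using a b by simp_all
  then have "\<And>v. a * v = 0 \<Longrightarrow> adj b * v = 0" and "\<And>v. b * v = 0 \<Longrightarrow> adj a * v = 0"
    by (simp_all add: bi_annihilator_subset_iff)
  then obtain u where "\<And>v. u * v = 0 \<longleftrightarrow> a * v = 0" "\<And>v. adj u * v = 0 \<longleftrightarrow> b * v = 0"
    using schroeder_bernstein_kernels[OF assms(1)] by blast
  then have "ann (ann {u}) = ann (ann {a})" and "ann (ann {adj u}) = ann (ann {b})"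
    by (simp_all add: bi_annihilator_eq_iff)
  then show ?thesis using a(1) b(1) by (auto simp: ann_equiv_def)
qed

end
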